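(* For TIM-MP/SIC problems with up to 4 users, orthogonal access achieves the linearly optimal symmetric DoF/rate for all topologies; that is, for every conflict digraph $\mathcal D$ on at most 4 vertices, $$d_{{\rm sym},l}(\mathcal D)=R_{{\rm sym},l}(\mathcal D)=\frac1{\chi_{A,f}(\mathcal D)} .$$
   Context: A conflict digraph $\mathcal D=(\mathcal V,\mathcal A)$ represents an interference problem in which each vertex $i$ is a message wanted by receiver $i$, and $(i,j)\in\mathcal A$ means message $i$ interferes at receiver $j$ (in TIM-MP: transmitter $i\ne j$ is connected to receiver $j$, transmitters know only the topology; in SIC: receiver $j$ of a noiseless broadcast link does not have message $i$ as side information). Receivers decode successively following a decoding order $\pi$ (a strict partial order $\prec_\pi$ on $\mathcal V$): receiver $j$ is given the messages $i\prec_\pi j$ and can remove their interference. Linear schemes: over a field $\mathbb F$ ($\mathbb C$ for TIM-MP, the binary field for SIC), a linear scheme with decoding order $\pi$ and length $r$ assigns to each $i\in\mathcal V$ a precoding matrix $\boldsymbol V_i\in\mathbb F^{r\times t_i}$ with linearly independent columns such that for each $j$ the column span of $\boldsymbol V_j$ intersects trivially the sum of the column spans of all $\boldsymbol V_i$ with $(i,j)\in\mathcal A$ and not $i\prec_\pi j$. It achieves the tuple $(t_i/r)_{i\in\mathcal V}$. The linearly achievable region is the convex hull of all tuples achieved over all decoding orders and lengths (time sharing over rounds with different decoding orders). The linear symmetric DoF $d_{{\rm sym},l}(\mathcal D)$ (TIM-MP) and linear symmetric rate $R_{{\rm sym},l}(\mathcal D)$ (SIC) are the suprema of $d$ such that $(d,\dots,d)$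 is in the respective linearly achievable region. Orthogonal access: time sharing among acyclic sets (vertex sets inducing no directed cycle), the messages of one acyclic set being sent simultaneously and decoded successively; its best symmetric value is $1/\chi_{A,f}(\mathcal D)$, where the fractional dichromatic number $\chi_{A,f}(\mathcal D)$ is the minimum of $\sum_A g(A)$ over $g$ from acyclic sets to $[0,1]$ with $\sum_{A\ni v}g(A)\ge1$ for every $v\in\mathcal V$. *)

theory Defs
  imports
    "HOL-Analysis.Analysis"
    "HOL-Library.Z2"
    "Jordan_Normal_Form.VS_Connect"
begin

text \<open>A conflict digraph is an irreflexive relation \<open>A\<close> on a finite type of vertices. The index
  \<open>i\<close> stands for both message \<open>i\<close> and receiver \<open>i\<close>, and \<open>(i, j) \<in> A\<close> means that message \<open>i\<close>
  interferes at receiver \<open>j\<close>. Pairs of opposite arcs are allowed and form directed cycles.\<close>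

definition decoding_order :: "('v \<times> 'v) set \<Rightarrow> bool" where
  "decoding_order p \<longleftrightarrow> irrefl p \<and> trans p"

context vec_space
begin

definition indep_cols :: "'a mat \<Rightarrow> bool" where
  "indep_cols M \<longleftrightarrow> distinct (cols M) \<and> lin_indpt (set (cols M))"

definition sum_of_subspaces :: "('v \<Rightarrow> 'a Matrix.vec set) \<Rightarrow> 'v set \<Rightarrow> 'a Matrix.vec set" where
  "sum_of_subspaces W I = {finsum V w I | w. \<forall>i\<in>I. w i \<in> W i}"

text \<open>The length of the scheme is the dimension \<open>n\<close> of the ambient space, and \<open>M i\<close> is the
  precoding matrix of message \<open>i\<close>. A matrix without columns is allowed.\<close>

definition linear_scheme ::
    "('v \<times> 'v) set \<Rightarrow> ('v \<times> 'v) set \<Rightarrow> ('v \<Rightarrow> 'a mat) \<Rightarrow> bool" where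
  "linear_scheme A p M \<longleftrightarrow>
     (\<forall>i. dim_row (M i) = n \<and> indep_cols (M i)) \<and>
     (\<forall>j. col_space (M j) \<inter>
          sum_of_subspaces (\<lambda>i. col_space (M i)) {i. (i, j) \<in> A \<and> (i, j) \<notin> p} = {0\<^sub>v n})"

end

definition lin_achieved ::
    "'f::field itself \<Rightarrow> ('v::finite \<times> 'v) set \<Rightarrow> (real ^ 'v) set" where
  "lin_achieved F A =
     {(\<chi> i. real (dim_col (M i)) / real r) | p r (M :: 'v \<Rightarrow> 'f mat).
        decoding_order p \<and> 0 < r \<and> vec_space.linear_scheme r A p M}"

definition lin_region ::
    "'f::field itself \<Rightarrow> ('v::finite \<times> 'v) set \<Rightarrow> (real ^ 'v) set" where
  "lin_region F A = convex hull (lin_achieved F A)"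

definition lin_sym :: "'f::field itself \<Rightarrow> ('v::finite \<times> 'v) set \<Rightarrow> real" where
  "lin_sym F A = Sup {d. (\<chi> i. d) \<in> lin_region F A}"

definition d_sym_l :: "('v::finite \<times> 'v) set \<Rightarrow> real" where
  "d_sym_l = lin_sym TYPE(complex)"

definition R_sym_l :: "('v::finite \<times> 'v) set \<Rightarrow> real" where
  "R_sym_l = lin_sym TYPE(bit)"

definition acyclic_sets :: "('v \<times> 'v) set \<Rightarrow> 'v set set" where
  "acyclic_sets A = {S. acyclic (Restr A S)}"

definition fractional_dicolouring :: "('v::finite \<times> 'v) set \<Rightarrow> ('v set \<Rightarrow> real) \<Rightarrow> bool" where
  "fractional_dicolouring A g \<longleftrightarrow>
     (\<forall>S\<in>acyclic_sets A. 0 \<le> g S \<and> g S \<le> 1) \<and>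
     (\<forall>v. (\<Sum>S\<in>{S \<in> acyclic_sets A. v \<in> S}. g S) \<ge> 1)"

text \<open>The infimum is a minimum: it is the value of a feasible linear program over a compact
  polytope.\<close>

definition frac_dichromatic :: "('v::finite \<times> 'v) set \<Rightarrow> real" where
  "frac_dichromatic A = Inf {(\<Sum>S\<in>acyclic_sets A. g S) | g. fractional_dicolouring A g}"

end

theory Submission
  imports Defs
begin

text \<open>On at most 4 vertices, over every field, the linearly achievable region is the convex hull of the
  incidence vectors of the acyclic sets; linear programming then turns its symmetric point into
  \<open>1 / frac_dichromatic A\<close>.

  For the outer bound, extend the decoding order to a linear order. Call two vertices adjacent if
  an arc between them goes backwards, i.e. its interference is not removed. Listing a clique in
  decoding order, the column space of each vertex meets the sum of the later ones trivially, so the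
  dimensions in a clique add up to at most the length \<open>r\<close>. A graph on at most 4 vertices is perfect,
  hence vertex \<open>i\<close> can be given \<open>dim_col (M i)\<close> of \<open>r\<close> colours with adjacent vertices getting disjoint
  sets. A colour class contains no backward arc and so is acyclic, and the rate tuple is the average
  of the incidence vectors of the \<open>r\<close> colour classes.\<close>

section \<open>Colouring weighted graphs on at most four vertices\<close>

text \<open>Two nonadjacent neighbours \<open>b\<close>, \<open>c\<close> of \<open>a\<close> each
  need a nonadjacent pair of neighbours of their own. With so few vertices, both pairs consist of
  \<open>a\<close> and one common fourth vertex, which closes a 4-cycle.\<close>

lemma card4_no_simplicial_vertex:
  assumes W: "finite W" "card W \<le> 4" "W \<noteq> {}"
    and sym: "\<And>i j. adj i j \<Longrightarrow> adj j i"
    and irrefl: "\<And>i. \<not> adj i i"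
    and ns: "\<And>v. v \<in> W \<Longrightarrow> \<exists>x\<in>W. \<exists>y\<in>W. x \<noteq> y \<and> adj v x \<and> adj v y \<and> \<not> adj x y"
  obtains a b c d where "W = {a, b, c, d}" "distinct [a, b, c, d]"
    "adj a b" "adj a c" "adj b d" "adj c d" "\<not> adj b c" "\<not> adj a d"
proof -
  have no5: "\<not> distinct [a, b, c, d, e]"
    if "{a, b, c, d, e} \<subseteq> W" for a b c d e
  proof
    assume "distinct [a, b, c, d, e]"
    then have "card {a, b, c, d, e} = 5" by simp
    with card_mono[OF W(1) that] W(2) show False by simp
  qed
  obtain a where a: "a \<in> W" using W(3) by blast
  obtain b c where bc: "b \<in> W" "c \<in> W" "b \<noteq> c" "adj a b" "adj a c" "\<not> adj b c"
    using ns[OF a] by blast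
  have abc: "a \<noteq> b" "a \<noteq> c" using bc irrefl by metis+
  \<comment> \<open>Since \<open>b\<close> and \<open>c\<close> are nonadjacent, \<open>x\<close>
    and \<open>y\<close> avoid both. A fifth vertex is excluded, so one of them is \<open>a\<close>
    and the other is the witness.\<close>
  have diag: "\<exists>d\<in>W. adj u d \<and> \<not> adj a d \<and> d \<noteq> a \<and> d \<noteq> b \<and> d \<noteq> c"
    if u: "u \<in> {b, c}" for u
  proof -
    obtain x y where xy: "x \<in> W" "y \<in> W" "x \<noteq> y" "adj u x" "adj u y" "\<not> adj x y"
      using ns[of u] u bc by blast
    have "x \<notin> {b, c}" "y \<notin> {b, c}"
      using u xy bc sym irrefl by blast+
    moreover have "x = a \<or> y = a"
      using no5[of a b c x y] a bc abc xy calculation by auto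
    ultimately show ?thesis using xy sym by blast
  qed
  obtain d where d: "d \<in> W" "adj b d" "\<not> adj a d" "d \<noteq> a" "d \<noteq> b" "d \<noteq> c"
    using diag[of b] by blast
  obtain d' where d': "d' \<in> W" "adj c d'" "d' \<noteq> a" "d' \<noteq> b" "d' \<noteq> c"
    using diag[of c] by blast
  have W_sub: "w \<in> {a, b, c, d}" if "w \<in> W" for w
    using no5[of a b c d w] that a bc abc d by auto
  have "d' = d" using W_sub[of d'] d' by blast
  moreover have "W = {a, b, c, d}" using W_sub a bc d by blast
  ultimately show ?thesis
    using that[of a b c d] bc abc d d' by auto
qed

text \<open>A graph on at most 4 vertices that has a simplicial vertex is coloured by removing that vertex;
  the only one that has none is the 4-cycle, where opposite vertices share colours from the same end
  of \<open>{..<r}\<close>.\<close>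

lemma clique_bound_imp_multicolouring:
  fixes t :: "'v \<Rightarrow> nat"
  assumes "finite W" "card W \<le> 4"
    and sym: "\<And>i j. adj i j \<Longrightarrow> adj j i"
    and irrefl: "\<And>i. \<not> adj i i"
    and "\<And>K. K \<subseteq> W \<Longrightarrow> (\<And>i j. i \<in> K \<Longrightarrow> j \<in> K \<Longrightarrow> i \<noteq> j \<Longrightarrow> adj i j) \<Longrightarrow> sum t K \<le> r"
  shows "\<exists>C. (\<forall>i\<in>W. C i \<subseteq> {..<r} \<and> card (C i) = t i) \<and>
             (\<forall>i\<in>W. \<forall>j\<in>W. adj i j \<longrightarrow> C i \<inter> C j = {})"
  using assms(1,2,5)
proof (induction W rule: finite_psubset_induct)
  case (psubset W)
  note clique = psubset.prems(2)
  show ?case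
  proof (cases "\<exists>v\<in>W. \<forall>x\<in>W. \<forall>y\<in>W. x \<noteq> y \<longrightarrow> adj v x \<longrightarrow> adj v y \<longrightarrow> adj x y")
    case True
    then obtain v where v: "v \<in> W"
      and simplicial: "\<And>x y. \<lbrakk>x \<in> W; y \<in> W; x \<noteq> y; adj v x; adj v y\<rbrakk> \<Longrightarrow> adj x y"
      by blast
    have "\<exists>C. (\<forall>i\<in>W - {v}. C i \<subseteq> {..<r} \<and> card (C i) = t i) \<and>
             (\<forall>i\<in>W - {v}. \<forall>j\<in>W - {v}. adj i j \<longrightarrow> C i \<inter> C j = {})"
    proof (rule psubset.IH)
      show "card (W - {v}) \<le> 4"
        using psubset.prems(1) card_Diff1_le[of W v] by linarith
    next
      show "W - {v} \<subset> W" using v by blast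
    next
      fix K assume K: "K \<subseteq> W - {v}" "\<And>i j. i \<in> K \<Longrightarrow> j \<in> K \<Longrightarrow> i \<noteq> j \<Longrightarrow> adj i j"
      show "sum t K \<le> r" using K(1) by (intro clique K(2)) blast+
    qed
    then obtain C where C: "\<forall>i\<in>W - {v}. C i \<subseteq> {..<r} \<and> card (C i) = t i"
      "\<forall>i\<in>W - {v}. \<forall>j\<in>W - {v}. adj i j \<longrightarrow> C i \<inter> C j = {}"
      by (elim exE conjE)
    \<comment> \<open>Together with \<open>v\<close> its neighbours form a clique, so they use at
      most \<open>r - t v\<close> colours and enough remain for \<open>v\<close>.\<close>
    define N where "N = {u \<in> W - {v}. adj v u}"
    define U where "U = (\<Union>u\<in>N. C u)"
    have N: "finite N" "v \<notin> N" "N \<subseteq> W" using psubset.hyps by (auto simp: N_def)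
    have "sum t (insert v N) \<le> r"
    proof (rule clique)
      show "insert v N \<subseteq> W" using v N by blast
      show "adj i j" if "i \<in> insert v N" "j \<in> insert v N" "i \<noteq> j" for i j
        using that simplicial sym unfolding N_def by blast
    qed
    moreover have "card U \<le> (\<Sum>u\<in>N. card (C u))"
      unfolding U_def by (rule card_UN_le) (use N in auto)
    moreover have "(\<Sum>u\<in>N. card (C u)) = sum t N"
      by (rule sum.cong) (use C in \<open>auto simp: N_def\<close>)
    moreover have "U \<subseteq> {..<r}" using C by (auto simp: U_def N_def)
    ultimately have "t v \<le> card ({..<r} - U)"
      using N by (simp add: card_Diff_subset finite_subset)
    then obtain D where D: "D \<subseteq> {..<r} - U" "card D = t v"
      by (metis obtain_subset_with_card_n)
    have "D \<inter> C u = {}" "C u \<inter> D = {}" if "u \<in> W - {v}" "adj v u \<or> adj u v" for u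
    proof -
      have "u \<in> N" using that sym by (auto simp: N_def)
      then show "D \<inter> C u = {}" "C u \<inter> D = {}" using D by (auto simp: U_def)
    qed
    with C D show ?thesis
      by (intro exI[of _ "C(v := D)"])
        (auto simp: irrefl)
  next
    case False
    show ?thesis
    proof (cases "W = {}")
      case True
      then show ?thesis by simp
    next
      case nonempty: False
      have ns: "\<exists>x\<in>W. \<exists>y\<in>W. x \<noteq> y \<and> adj v x \<and> adj v y \<and> \<not> adj x y" if "v \<in> W" for v
        using False that by blast
      obtain a b c d where W: "W = {a, b, c, d}" "distinct [a, b, c, d]"
        and adj: "adj a b" "adj a c" "adj b d" "adj c d" "\<not> adj b c" "\<not> adj a d"
        by (rule card4_no_simplicial_vertex
            [OF psubset.hyps psubset.prems(1) nonempty sym irrefl ns])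
      have edge: "t x + t y \<le> r" if "x \<in> W" "y \<in> W" "adj x y" for x y
      proof -
        have "sum t {x, y} \<le> r" by (rule clique) (use that sym in blast)+
        then show ?thesis using that irrefl by (cases "x = y") auto
      qed
      have e: "t a + t b \<le> r" "t a + t c \<le> r" "t b + t d \<le> r" "t c + t d \<le> r"
        by (auto intro!: edge simp: W adj)
      \<comment> \<open>Edges run only between \<open>{a, d}\<close> and \<open>{b, c}\<close>,
        where \<open>t x + t y \<le> r\<close> keeps an initial and a final segment disjoint. It
        also gives \<open>t i \<le> r\<close>, so the truncated subtraction leaves exactly
        \<open>t i\<close> colours.\<close>
      define C where "C i = (if i \<in> {a, d} then {..<t i} else {r - t i..<r})" for i
      show ?thesis
        by (rule exI[of _ C]) (use e W adj in \<open>auto simp: C_def irrefl dest: sym\<close>)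
    qed
  qed
qed

section \<open>Linear schemes and dimension counting\<close>

context vec_space
begin

text \<open>In a vanishing combination the \<open>X\<close> part is the negative of the
  \<open>Y\<close> part, so it lies in both spans and is zero. A common element of \<open>X\<close>
  and \<open>Y\<close> would likewise be zero, which no independent set contains.\<close>

lemma lin_indpt_Un_disjoint_spans:
  assumes XY: "finite X" "finite Y" "X \<subseteq> carrier_vec n" "Y \<subseteq> carrier_vec n"
    and li: "lin_indpt X" "lin_indpt Y"
    and disj: "span X \<inter> span Y \<subseteq> {0\<^sub>v n}"
  shows "X \<inter> Y = {}" "lin_indpt (X \<union> Y)"
proof -
  have "X \<inter> Y \<subseteq> {0\<^sub>v n}"
    using disj in_own_span[of X] in_own_span[of Y] XY by auto
  moreover have "0\<^sub>v n \<notin> X" using vs_zero_lin_dep[of X] XY li by auto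
  ultimately show XY0: "X \<inter> Y = {}" by blast
  show "lin_indpt (X \<union> Y)"
  proof (rule finite_lin_indpt2)
    fix a :: "'a vec \<Rightarrow> 'a"
    assume "lincomb a (X \<union> Y) = 0\<^sub>v n"
    then have sum0: "lincomb a X + lincomb a Y = 0\<^sub>v n"
      using lincomb_union[of X Y a] XY XY0 by simp
    have c: "lincomb a X \<in> carrier_vec n" "lincomb a Y \<in> carrier_vec n"
      using XY by auto
    have spans: "lincomb a X \<in> span X" "lincomb a Y \<in> span Y"
      using XY by (auto simp: finite_span)
    have "lincomb a X = - lincomb a Y"
      using sum0 c by (metis M.minus_equality cV vec_neg add.commute comm_add_vec)
    then have "lincomb a X \<in> span Y"
      using span_neg[of Y "lincomb a Y"] spans XY c by simp
    with spans disj have X0: "lincomb a X = 0\<^sub>v n" by blast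
    with sum0 c have Y0: "lincomb a Y = 0\<^sub>v n" by simp
    show "\<forall>v\<in>X \<union> Y. a v = 0"
      using lin_dep_crit[where A=X and S=X and a=a] lin_dep_crit[where A=Y and S=Y and a=a] X0 Y0 XY li by auto
  qed (use XY in auto)
qed

lemma zero_in_sum_of_subspaces:
  assumes "\<And>i. i \<in> I \<Longrightarrow> 0\<^sub>v n \<in> W i"
  shows "0\<^sub>v n \<in> sum_of_subspaces W I"
  unfolding sum_of_subspaces_def
  by (auto intro!: exI[of _ "\<lambda>_. 0\<^sub>v n"] simp: assms)

lemma sum_of_subspaces_trivial:
  assumes "\<And>i. i \<in> I \<Longrightarrow> W i = {0\<^sub>v n}"
  shows "sum_of_subspaces W I = {0\<^sub>v n}"
proof
  show "sum_of_subspaces W I \<subseteq> {0\<^sub>v n}"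
    unfolding sum_of_subspaces_def using assms by (auto intro!: M.finsum_all0)
qed (use assms zero_in_sum_of_subspaces[of I W] in auto)

text \<open>The induction runs over \<open>K\<close> with \<open>I\<close> fixed: summands outside
  \<open>K\<close> are kept at zero, so that a new \<open>j\<close> can be given its own
  component.\<close>

lemma span_UN_subset_sum_of_subspaces:
  assumes "finite I" "K \<subseteq> I" "\<And>i. i \<in> I \<Longrightarrow> X i \<subseteq> carrier_vec n"
  shows "span (\<Union>i\<in>K. X i) \<subseteq> sum_of_subspaces (\<lambda>i. span (X i)) I"
proof -
  have "\<exists>w. (\<forall>i\<in>I. w i \<in> span (X i)) \<and> (\<forall>i\<in>I - K. w i = 0\<^sub>v n) \<and> finsum V w I = x"
    if "finite K" "K \<subseteq> I" "x \<in> span (\<Union>i\<in>K. X i)" for x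
    using that
  proof (induction K arbitrary: x)
    case empty
    then show ?case
      by (intro exI[of _ "\<lambda>_. 0\<^sub>v n"]) (auto simp: span_empty span_zero)
  next
    case (insert j K)
    have sub: "X j \<subseteq> carrier_vec n" "(\<Union>i\<in>K. X i) \<subseteq> carrier_vec n"
      using insert.prems assms(3) by auto
    have "x \<in> span (X j \<union> (\<Union>i\<in>K. X i))" using insert.prems by simp
    then obtain u y where uy: "u \<in> span (X j)" "y \<in> span (\<Union>i\<in>K. X i)" "x = u + y"
      using span_union_is_sum[OF sub] by (auto simp: submodule_sum_def)
    obtain w where w: "\<And>i. i \<in> I \<Longrightarrow> w i \<in> span (X i)" "\<And>i. i \<in> I - K \<Longrightarrow> w i = 0\<^sub>v n"
      "finsum V w I = y"
      using insert.IH[OF _ uy(2)] insert.prems by blast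
    have wc: "w \<in> I \<rightarrow> carrier_vec n" using span_closed[OF assms(3) w(1)] by blast
    have uc: "u \<in> carrier_vec n" using span_closed[OF sub(1) uy(1)] by simp
    have j: "j \<in> I" "w j = 0\<^sub>v n" using w(2)[of j] insert by auto
    have "finsum V (w(j := u)) I = finsum V (w(j := u)) (insert j (I - {j}))"
      using j by (simp add: insert_absorb)
    also have "\<dots> = u + finsum V (w(j := u)) (I - {j})"
      using assms(1) wc uc by (subst M.finsum_insert) auto
    also have "finsum V (w(j := u)) (I - {j}) = finsum V w (I - {j})"
      by (rule M.finsum_cong') (use wc in auto)
    \<comment> \<open>Because \<open>w j\<close> is zero, leaving out \<open>j\<close> does not
      change the sum.\<close>
    also have "\<dots> = y"
    proof -
      have "finsum V w (insert j (I - {j})) = w j + finsum V w (I - {j})"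
        using assms(1) wc j by (subst M.finsum_insert) auto
      moreover have "finsum V w (I - {j}) \<in> carrier_vec n"
        by (rule M.finsum_closed[simplified]) (use wc in auto)
      ultimately show ?thesis using w(3) j by (simp add: insert_absorb)
    qed
    finally show ?case
      using w uy j insert.hyps by (intro exI[of _ "w(j := u)"]) auto
  qed
  moreover have "finite K" using assms(1,2) finite_subset by blast
  ultimately show ?thesis
    using assms(2) unfolding sum_of_subspaces_def by blast
qed

text \<open>The columns of all vertices in \<open>K\<close> form one independent set, hence number
  at most \<open>n\<close>. The induction removes the vertex that \<open>h\<close> lists
  first.\<close>

lemma linear_scheme_sum_dim_col_le:
  fixes A :: "('v::finite \<times> 'v) set" and h :: "'v \<Rightarrow> nat"
  assumes scheme: "linear_scheme A p M" and inj: "inj_on h K"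
    and backward: "\<And>i j. \<lbrakk>i \<in> K; j \<in> K; h j < h i\<rbrakk> \<Longrightarrow> (i, j) \<in> A - p"
  shows "(\<Sum>i\<in>K. dim_col (M i)) \<le> n"
proof -
  define X where "X i = set (cols (M i))" for i
  have X: "finite (X i)" "X i \<subseteq> carrier_vec n" "lin_indpt (X i)" "card (X i) = dim_col (M i)" for i
    using scheme cols_dim[of "M i"]
    by (auto simp: X_def linear_scheme_def indep_cols_def distinct_card)
  have "lin_indpt (\<Union>i\<in>K. X i) \<and> card (\<Union>i\<in>K. X i) = (\<Sum>i\<in>K. dim_col (M i))"
    using finite[of K] inj backward
  proof (induction K rule: finite_psubset_induct)
    case (psubset K)
    show ?case
    proof (cases "K = {}")
      case True
      then show ?thesis by (auto simp: lin_dep_def)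
    next
      case False
      then obtain j where j: "j \<in> K" "\<And>i. i \<in> K \<Longrightarrow> h j \<le> h i"
        using ex_min_if_finite[of "h ` K"] by (metis arg_min_if_finite(1) arg_min_least finite)
      define Y where "Y = (\<Union>i\<in>K - {j}. X i)"
      have IH: "lin_indpt Y" "card Y = (\<Sum>i\<in>K - {j}. dim_col (M i))"
        using psubset.IH[of "K - {j}"] psubset.prems j(1)
        by (auto simp: Y_def inj_on_diff)
      have Y: "finite Y" "Y \<subseteq> carrier_vec n" using X by (auto simp: Y_def)
      define I where "I = {i. (i, j) \<in> A \<and> (i, j) \<notin> p}"
      \<comment> \<open>All other vertices of \<open>K\<close> come later than \<open>j\<close>, so
        they interfere at \<open>j\<close> unremoved and decodability at \<open>j\<close> separates
        their columns from those of \<open>j\<close>.\<close>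
      have "K - {j} \<subseteq> I"
      proof
        fix i assume i: "i \<in> K - {j}"
        then have "h i \<noteq> h j" using psubset.prems(1) j(1) by (auto dest: inj_onD)
        then have "h j < h i" using j(2)[of i] i by simp
        then show "i \<in> I" using psubset.prems(2)[of i j] i j(1) by (auto simp: I_def)
      qed
      then have "span Y \<subseteq> sum_of_subspaces (\<lambda>i. span (X i)) I"
        unfolding Y_def by (intro span_UN_subset_sum_of_subspaces) (use X in auto)
      moreover have "span (X j) \<inter> sum_of_subspaces (\<lambda>i. span (X i)) I = {0\<^sub>v n}"
        using scheme by (simp add: linear_scheme_def col_space_def X_def I_def)
      ultimately have "span (X j) \<inter> span Y \<subseteq> {0\<^sub>v n}" by blast
      then have "X j \<inter> Y = {}" "lin_indpt (X j \<union> Y)"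
        using lin_indpt_Un_disjoint_spans[of "X j" Y] X Y IH by auto
      moreover have "(\<Union>i\<in>K. X i) = X j \<union> Y" using j(1) by (auto simp: Y_def)
      ultimately show ?thesis
        using IH X Y j(1) by (simp add: card_Un_disjoint sum.remove)
    qed
  qed
  moreover have "(\<Union>i\<in>K. X i) \<subseteq> carrier_vec n" using X by auto
  ultimately show ?thesis
    using li_le_dim(2)[of "\<Union>i\<in>K. X i"] by (simp add: dim_is_n)
qed

text \<open>In length 1 each member of \<open>S\<close> sends a scalar and the others send nothing.
  Arcs inside \<open>S\<close> belong to the order, so the interferers left at a member of
  \<open>S\<close> are silent.\<close>

lemma linear_scheme_acyclic_set:
  fixes A :: "('v \<times> 'v) set" and S :: "'v set"
  assumes "n = 1"
  defines "M \<equiv> \<lambda>i. if i \<in> S then 1\<^sub>m 1 else 0\<^sub>m 1 0"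
  shows "linear_scheme A ((Restr A S)\<^sup>+) M"
proof -
  have col0: "col_space (M i) = {0\<^sub>v n}" if "i \<notin> S" for i
    using that by (simp add: M_def col_space_def cols_def span_empty)
  have zero: "0\<^sub>v n \<in> col_space (M i)" for i
    using span_zero by (simp add: col_space_def)
  have "indep_cols (M i)" for i
  proof (cases "i \<in> S")
    case True
    have "lin_indpt (set (unit_vecs n))" using unit_vecs_basis by (simp add: basis_def)
    moreover have "cols (M i) = unit_vecs n"
      using True assms(1) by (simp add: M_def unit_vecs_def cols_def)
    ultimately show ?thesis by (simp add: indep_cols_def unit_vecs_distinct)
  next
    case False
    then show ?thesis by (auto simp: indep_cols_def M_def cols_def lin_dep_def)
  qed
  moreover have "col_space (M j) \<inter>
      sum_of_subspaces (\<lambda>i. col_space (M i)) {i. (i, j) \<in> A \<and> (i, j) \<notin> (Restr A S)\<^sup>+} = {0\<^sub>v n}"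
    (is "_ \<inter> sum_of_subspaces ?W ?I = _") for j
  proof (cases "j \<in> S")
    case True
    then have "?W i = {0\<^sub>v n}" if "i \<in> ?I" for i using that by (intro col0) auto
    then have "sum_of_subspaces ?W ?I = {0\<^sub>v n}" by (rule sum_of_subspaces_trivial)
    then show ?thesis using zero by simp
  next
    case False
    have "0\<^sub>v n \<in> sum_of_subspaces ?W ?I" by (intro zero_in_sum_of_subspaces zero)
    then show ?thesis by (simp add: col0 False)
  qed
  moreover have "dim_row (M i) = n" for i using assms(1) by (simp add: M_def)
  ultimately show ?thesis by (simp add: linear_scheme_def)
qed
end

no_notation Matrix.vec_index (infixl \<open>$\<close> 100)

section \<open>The achievable region as a hull of incidence vectors\<close>

text \<open>Vertices are ranked by their number of predecessors, with ties broken by an arbitrary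
  enumeration \<open>e\<close>.\<close>

lemma decoding_order_numbering:
  fixes p :: "('v::finite \<times> 'v) set"
  assumes "decoding_order p"
  obtains h :: "'v \<Rightarrow> nat" where "inj h" "\<And>i j. (i, j) \<in> p \<Longrightarrow> h i < h j"
proof -
  obtain e :: "'v \<Rightarrow> nat" where e: "bij_betw e UNIV {0..<CARD('v)}"
    using ex_bij_betw_finite_nat[OF finite] by blast
  have e_less: "e v < CARD('v)" for v using bij_betwE[OF e] by simp
  define c where "c v = card {u. (u, v) \<in> p}" for v
  define h where "h v = c v * CARD('v) + e v" for v
  show ?thesis
  proof
    \<comment> \<open>The tie-breaker stays below \<open>CARD('v)\<close>, so it is recovered as a
      remainder.\<close>
    have "h v mod CARD('v) = e v" for v using e_less by (simp add: h_def)
    then show "inj h" using e by (metis bij_betw_imp_inj_on injD injI)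
    fix u v assume uv: "(u, v) \<in> p"
    \<comment> \<open>The inclusion is strict because \<open>u\<close> precedes \<open>v\<close> but
      not itself.\<close>
    have "{w. (w, u) \<in> p} \<subset> {w. (w, v) \<in> p}"
      using uv assms by (auto simp: decoding_order_def irrefl_def dest: transD)
    then have "Suc (c u) \<le> c v" unfolding c_def by (simp add: psubset_card_mono Suc_leI)
    then have "Suc (c u) * CARD('v) \<le> c v * CARD('v)" by (rule mult_le_mono1)
    then show "h u < h v" using e_less[of u] by (simp add: h_def)
  qed
qed

definition incidence :: "'v set \<Rightarrow> real ^ 'v" where
  "incidence S = (\<chi> i. of_bool (i \<in> S))"

lemma incidence_nth [simp]: "incidence S $ i = of_bool (i \<in> S)"
  by (simp add: incidence_def)

lemma inj_incidence: "inj incidence"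
  by (rule injI) (auto simp: Finite_Cartesian_Product.vec_eq_iff set_eq_iff of_bool_eq_iff)

lemma acyclic_sets_subset: "\<lbrakk>S \<in> acyclic_sets A; T \<subseteq> S\<rbrakk> \<Longrightarrow> T \<in> acyclic_sets A"
  unfolding acyclic_sets_def by (auto elim!: acyclic_subset)

lemma singleton_in_acyclic_sets:
  assumes "irrefl A"
  shows "{v} \<in> acyclic_sets A"
proof -
  have "Restr A {v} = {}" using assms by (auto simp: irrefl_def)
  then show ?thesis by (simp add: acyclic_sets_def acyclic_def)
qed

lemma incidence_in_lin_achieved:
  fixes A :: "('v::finite \<times> 'v) set"
  assumes "S \<in> acyclic_sets A"
  shows "incidence S \<in> lin_achieved TYPE('f::field) A"
proof -
  define M :: "'v \<Rightarrow> 'f mat" where "M = (\<lambda>i. if i \<in> S then 1\<^sub>m 1 else 0\<^sub>m 1 0)"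
  \<comment> \<open>Acyclicity is exactly irreflexivity of the transitive closure.\<close>
  have "decoding_order ((Restr A S)\<^sup>+)"
    using assms by (auto simp: decoding_order_def acyclic_sets_def acyclic_def irrefl_def)
  moreover have "vec_space.linear_scheme 1 A ((Restr A S)\<^sup>+) M"
    unfolding M_def by (rule vec_space.linear_scheme_acyclic_set) simp
  moreover have "incidence S = (\<chi> i. real (dim_col (M i)) / real 1)"
    by (simp add: M_def Finite_Cartesian_Product.vec_eq_iff)
  ultimately show ?thesis unfolding lin_achieved_def by blast
qed

lemma lin_achieved_subset_hull:
  fixes A :: "('v::finite \<times> 'v) set"
  assumes A: "irrefl A" and card: "CARD('v) \<le> 4"
  shows "lin_achieved TYPE('f::field) A \<subseteq> convex hull (incidence ` acyclic_sets A)"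
proof
  fix x assume "x \<in> lin_achieved TYPE('f) A"
  then obtain p r and M :: "'v \<Rightarrow> 'f mat" where p: "decoding_order p" and r: "0 < r"
    and scheme: "vec_space.linear_scheme r A p M"
    and x: "x = (\<chi> i. real (dim_col (M i)) / real r)"
    unfolding lin_achieved_def by blast
  obtain h :: "'v \<Rightarrow> nat" where h: "inj h" "\<And>i j. (i, j) \<in> p \<Longrightarrow> h i < h j"
    using decoding_order_numbering[OF p] by blast
  \<comment> \<open>Adjacency is the symmetrised relation of arcs going backwards along
    \<open>h\<close>; such arcs cannot lie in \<open>p\<close>. A pair of opposite arcs is always
    adjacent.\<close>
  define adj where
    "adj i j \<longleftrightarrow> (i, j) \<in> A \<and> h j < h i \<or> (j, i) \<in> A \<and> h i < h j" for i j
  have "\<exists>C. (\<forall>i\<in>UNIV. C i \<subseteq> {..<r} \<and> card (C i) = dim_col (M i)) \<and>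
            (\<forall>i\<in>UNIV. \<forall>j\<in>UNIV. adj i j \<longrightarrow> C i \<inter> C j = {})"
  proof (rule clique_bound_imp_multicolouring)
    fix K assume clique: "\<And>i j. i \<in> K \<Longrightarrow> j \<in> K \<Longrightarrow> i \<noteq> j \<Longrightarrow> adj i j"
    show "(\<Sum>i\<in>K. dim_col (M i)) \<le> r"
    proof (rule vec_space.linear_scheme_sum_dim_col_le[OF scheme, where h = h])
      show "inj_on h K" using h(1) by (rule inj_on_subset) simp
      show "(i, j) \<in> A - p" if "i \<in> K" "j \<in> K" "h j < h i" for i j
        using clique[of i j] that h(2)[of i j] by (auto simp: adj_def)
    qed
  qed (use card in \<open>auto simp: adj_def\<close>)
  then obtain C where C: "\<And>i. C i \<subseteq> {..<r}" "\<And>i. card (C i) = dim_col (M i)"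
    "\<And>i j. adj i j \<Longrightarrow> C i \<inter> C j = {}"
    by (metis UNIV_I)
  define S where "S k = {i. k \<in> C i}" for k
  have "S k \<in> acyclic_sets A" for k
  proof -
    have "h i < h j" if "(i, j) \<in> A" "i \<in> S k" "j \<in> S k" for i j
    proof -
      have "i \<noteq> j" using that(1) A by (auto simp: irrefl_def)
      then have "h i \<noteq> h j" using h(1) by (auto dest: injD)
      moreover have "\<not> adj i j" using C(3)[of i j] that by (auto simp: S_def)
      ultimately show ?thesis using that(1) by (auto simp: adj_def)
    qed
    \<comment> \<open>Every arc left inside a colour class increases \<open>h\<close>, which rules
      out cycles.\<close>
    then have "Restr A (S k) \<subseteq> inv_image less_than h" by auto
    then have "acyclic (Restr A (S k))"
      by (rule acyclic_subset[OF wf_acyclic[OF wf_inv_image[OF wf_less_than]]])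
    then show ?thesis by (simp add: acyclic_sets_def)
  qed
  moreover have "x = (\<Sum>k<r. (1 / real r) *\<^sub>R incidence (S k))"
  proof -
    \<comment> \<open>Vertex \<open>i\<close> lies in as many colour classes as it has
      colours.\<close>
    have "(\<Sum>k<r. of_bool (k \<in> C i) :: real) = real (dim_col (M i))" for i
      using C(1)[of i] by (simp add: C(2)[symmetric] Int_absorb1 flip: Int_def)
    then show ?thesis
      by (simp add: x Finite_Cartesian_Product.vec_eq_iff S_def flip: sum_divide_distrib)
  qed
  ultimately show "x \<in> convex hull (incidence ` acyclic_sets A)"
    using r convex_sum[OF finite_lessThan convex_convex_hull[of "incidence ` acyclic_sets A"],
        where k1 = r and a = "\<lambda>_. 1 / real r" and y = "\<lambda>k. incidence (S k)"]
    by (auto intro: hull_inc)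
qed

text \<open>The right-hand side does not mention the field, so the complex and the binary value
  agree.\<close>

lemma lin_region_eq_hull:
  fixes A :: "('v::finite \<times> 'v) set"
  assumes "irrefl A" and "CARD('v) \<le> 4"
  shows "lin_region TYPE('f::field) A = convex hull (incidence ` acyclic_sets A)"
  unfolding lin_region_def
proof
  show "convex hull lin_achieved TYPE('f) A \<subseteq> convex hull (incidence ` acyclic_sets A)"
    by (intro hull_minimal lin_achieved_subset_hull assms convex_convex_hull)
  show "convex hull (incidence ` acyclic_sets A) \<subseteq> convex hull lin_achieved TYPE('f) A"
    by (intro hull_mono image_subsetI incidence_in_lin_achieved)
qed

section \<open>Convex weights and fractional dicolourings\<close>

text \<open>Injectivity of \<open>incidence\<close> lets the convex weights be indexed by sets, as
  in a dicolouring.\<close>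

lemma mem_hull_incidence_iff:
  fixes \<A> :: "'v::finite set set"
  shows "x \<in> convex hull (incidence ` \<A>) \<longleftrightarrow>
    (\<exists>g. (\<forall>S\<in>\<A>. 0 \<le> g S) \<and> sum g \<A> = 1 \<and> (\<Sum>S\<in>\<A>. g S *\<^sub>R incidence S) = x)"
    (is "?L \<longleftrightarrow> ?R")
proof
  have inj: "inj_on incidence \<A>" using inj_incidence by (rule inj_on_subset) simp
  assume ?L
  then obtain u where "\<forall>y\<in>incidence ` \<A>. 0 \<le> u y" "sum u (incidence ` \<A>) = 1"
    "(\<Sum>y\<in>incidence ` \<A>. u y *\<^sub>R y) = x"
    by (auto simp: convex_hull_finite)
  then show ?R
    using inj by (intro exI[of _ "u \<circ> incidence"]) (simp add: sum.reindex)
next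
  assume ?R
  then show ?L
    using convex_sum[OF finite convex_convex_hull[of "incidence ` \<A>"],
        where S = \<A> and y = incidence]
    by (auto intro: hull_inc)
qed

lemma sum_scaleR_incidence_nth:
  fixes \<A> :: "'v::finite set set"
  shows "(\<Sum>S\<in>\<A>. g S *\<^sub>R incidence S) $ v = (\<Sum>S\<in>{S \<in> \<A>. v \<in> S}. g S)"
  by (simp add: sum.inter_filter of_bool_def if_distrib cong: if_cong)

text \<open>Deleting \<open>v\<close> from every set is a linear projection that preserves the
  generators, so the hull is closed under zeroing a coordinate. Mixing a point with its projection
  lowers that coordinate by any factor.\<close>

lemma hull_incidence_downward_closed:
  fixes \<A> :: "'v::finite set set"
  assumes x: "x \<in> convex hull (incidence ` \<A>)"
    and \<A>: "\<And>S T. \<lbrakk>S \<in> \<A>; T \<subseteq> S\<rbrakk> \<Longrightarrow> T \<in> \<A>"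
    and y: "\<And>i. 0 \<le> y $ i" "\<And>i. y $ i \<le> x $ i"
  shows "y \<in> convex hull (incidence ` \<A>)"
proof -
  let ?H = "convex hull (incidence ` \<A>)"
  have erase: "(\<chi> i. if i = v then 0 else z $ i) \<in> ?H" if "z \<in> ?H" for z v
  proof -
    define P :: "real ^ 'v \<Rightarrow> real ^ 'v" where "P z = (\<chi> i. if i = v then 0 else z $ i)" for z
    have "linear P" by (rule linearI) (auto simp: P_def Finite_Cartesian_Product.vec_eq_iff)
    then have "P ` ?H = convex hull (P ` incidence ` \<A>)" by (rule convex_hull_linear_image)
    also have "P ` incidence ` \<A> \<subseteq> incidence ` \<A>"
    proof safe
      fix S assume "S \<in> \<A>"
      then have "S - {v} \<in> \<A>" using \<A> by blast
      moreover have "P (incidence S) = incidence (S - {v})" by (auto simp: P_def Finite_Cartesian_Product.vec_eq_iff)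
      ultimately show "P (incidence S) \<in> incidence ` \<A>" by simp
    qed
    then have "convex hull (P ` incidence ` \<A>) \<subseteq> ?H" by (rule hull_mono)
    finally have "P z \<in> ?H" using that by blast
    then show ?thesis by (simp add: P_def)
  qed
  have "(\<chi> i. if i \<in> T then y $ i else x $ i) \<in> ?H" for T
    using finite[of T]
  proof (induction T)
    case empty
    then show ?case using x by simp
  next
    case (insert v T)
    define z where "z = (\<chi> i. if i \<in> T then y $ i else x $ i)"
    \<comment> \<open>If \<open>x $ v\<close> is zero then so is \<open>y $ v\<close>, and division
      by zero gives the suitable value \<open>l = 0\<close>.\<close>
    define l where "l = y $ v / x $ v"
    have l: "0 \<le> l" "l \<le> 1" "l * x $ v = y $ v"
      using y[of v] by (auto simp: l_def divide_le_eq_1 not_le)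
    \<comment> \<open>The two points agree off \<open>v\<close>, so only that coordinate moves, to
      \<open>l * x $ v\<close>.\<close>
    have "l *\<^sub>R z + (1 - l) *\<^sub>R (\<chi> i. if i = v then 0 else z $ i) \<in> ?H"
      by (rule convexD[OF convex_convex_hull]) (use insert.IH erase l in \<open>auto simp: z_def\<close>)
    also have "l *\<^sub>R z + (1 - l) *\<^sub>R (\<chi> i. if i = v then 0 else z $ i) =
        (\<chi> i. if i \<in> insert v T then y $ i else x $ i)"
      using l(3) insert.hyps by (auto simp: Finite_Cartesian_Product.vec_eq_iff z_def algebra_simps)
    finally show ?case .
  qed
  from this[of UNIV] show ?thesis by simp
qed

text \<open>Dividing convex weights by \<open>d\<close> turns the common coverage \<open>d\<close>
  into 1 and bounds the total by \<open>1 / d\<close>.\<close>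

lemma fractional_dicolouring_of_hull:
  fixes A :: "('v::finite \<times> 'v) set"
  assumes d: "(\<chi> i. d) \<in> convex hull (incidence ` acyclic_sets A)" "0 < d"
  shows "\<exists>g. fractional_dicolouring A g \<and> sum g (acyclic_sets A) \<le> 1 / d"
proof -
  obtain g where g: "\<And>S. S \<in> acyclic_sets A \<Longrightarrow> 0 \<le> g S" "sum g (acyclic_sets A) = 1"
    and gd: "(\<Sum>S\<in>acyclic_sets A. g S *\<^sub>R incidence S) = (\<chi> i. d)"
    using d(1) unfolding mem_hull_incidence_iff by blast
  have cover: "(\<Sum>S\<in>{S \<in> acyclic_sets A. v \<in> S}. g S) = d" for v
    using sum_scaleR_incidence_nth[of g "acyclic_sets A" v] gd by simp
  txt \<open>The empty set is the only one whose rescaled weight can exceed 1.\<close>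
  define g' where "g' S = (if S = {} then 0 else g S / d)" for S
  have "0 \<le> g' S \<and> g' S \<le> 1" if S: "S \<in> acyclic_sets A" for S
  proof (cases "S = {}")
    case False
    then obtain v where "v \<in> S" by blast
    \<comment> \<open>The weight of \<open>S\<close> is one of the nonnegative summands in the
      coverage of \<open>v\<close>.\<close>
    then have "g S \<le> d"
      using member_le_sum[of S "{S \<in> acyclic_sets A. v \<in> S}" g] g(1) S cover[of v] by simp
    then show ?thesis using g(1)[OF S] d(2) by (simp add: g'_def)
  qed (simp add: g'_def)
  moreover have "(\<Sum>S\<in>{S \<in> acyclic_sets A. v \<in> S}. g' S) = 1" for v
  proof -
    have "(\<Sum>S\<in>{S \<in> acyclic_sets A. v \<in> S}. g' S) = (\<Sum>S\<in>{S \<in> acyclic_sets A. v \<in> S}. g S / d)"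
      by (rule sum.cong) (auto simp: g'_def)
    then show ?thesis using cover[of v] d(2) by (simp flip: sum_divide_distrib)
  qed
  moreover have "sum g' (acyclic_sets A) \<le> (\<Sum>S\<in>acyclic_sets A. g S / d)"
    by (rule sum_mono) (use g(1) d(2) in \<open>auto simp: g'_def\<close>)
  then have "sum g' (acyclic_sets A) \<le> 1 / d"
    using g(2) by (simp flip: sum_divide_distrib)
  ultimately show ?thesis unfolding fractional_dicolouring_def by (metis order_refl)
qed

lemma fractional_dicolouring_sum_ge_1:
  assumes "fractional_dicolouring A g"
  shows "1 \<le> sum g (acyclic_sets A)"
proof -
  \<comment> \<open>Types are nonempty, so there is a vertex, and covering it already takes weight
    1.\<close>
  fix v :: 'a
  have "1 \<le> (\<Sum>S\<in>{S \<in> acyclic_sets A. v \<in> S}. g S)"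
    using assms by (simp add: fractional_dicolouring_def)
  also have "\<dots> \<le> sum g (acyclic_sets A)"
    by (rule sum_mono2) (use assms in \<open>auto simp: fractional_dicolouring_def\<close>)
  finally show ?thesis .
qed

text \<open>Normalising the weights to total 1 gives a point whose coordinates are at least the
  required value; downward closure removes the excess from vertices covered more than once.\<close>

lemma hull_of_fractional_dicolouring:
  fixes A :: "('v::finite \<times> 'v) set"
  assumes g: "fractional_dicolouring A g"
  shows "(\<chi> i. 1 / sum g (acyclic_sets A)) \<in> convex hull (incidence ` acyclic_sets A)"
proof (rule hull_incidence_downward_closed)
  define s where "s = sum g (acyclic_sets A)"
  have s: "1 \<le> s" unfolding s_def by (rule fractional_dicolouring_sum_ge_1[OF g])
  let ?x = "\<Sum>S\<in>acyclic_sets A. (g S / s) *\<^sub>R incidence S"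
  show "?x \<in> convex hull (incidence ` acyclic_sets A)"
    unfolding mem_hull_incidence_iff using g s
    by (intro exI[of _ "\<lambda>S. g S / s"])
      (auto simp: fractional_dicolouring_def s_def simp flip: sum_divide_distrib)
  show "(\<chi> i. 1 / sum g (acyclic_sets A)) $ v \<le> ?x $ v" for v
    using g s unfolding sum_scaleR_incidence_nth
    by (simp add: fractional_dicolouring_def divide_right_mono flip: s_def sum_divide_distrib)
  show "0 \<le> (\<chi> i. 1 / sum g (acyclic_sets A)) $ v" for v
    using s by (simp flip: s_def)
qed (rule acyclic_sets_subset)

text \<open>Giving weight 1 to each singleton works; this keeps the infimum from ranging over an
  empty set.\<close>

lemma fractional_dicolouring_exists:
  assumes "irrefl A"
  shows "\<exists>g. fractional_dicolouring A g"
proof -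
  have "(1::real) \<le> (\<Sum>S\<in>{S \<in> acyclic_sets A. v \<in> S}. of_bool (\<exists>u. S = {u}))" for v
    using member_le_sum[of "{v}" "{S \<in> acyclic_sets A. v \<in> S}"
        "\<lambda>S. of_bool (\<exists>u. S = {u}) :: real"]
      singleton_in_acyclic_sets[OF assms, of v] by simp
  then have "fractional_dicolouring A (\<lambda>S. of_bool (\<exists>u. S = {u}))"
    by (simp add: fractional_dicolouring_def)
  then show ?thesis by blast
qed

section \<open>The symmetric value\<close>

text \<open>Each dicolouring value has its reciprocal in the symmetric set, and each positive
  \<open>d\<close> there is matched by a dicolouring value at most \<open>1 / d\<close>. Comparing
  supremum and infimum this way avoids showing that either is attained.\<close>

lemma lin_sym_eq_inverse_frac_dichromatic:
  fixes A :: "('v::finite \<times> 'v) set"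
  assumes "irrefl A" and "CARD('v) \<le> 4"
  shows "lin_sym TYPE('f::field) A = 1 / frac_dichromatic A"
proof -
  define H where "H = convex hull (incidence ` acyclic_sets A)"
  define G where "G = {sum g (acyclic_sets A) | g. fractional_dicolouring A g}"
  have G1: "1 \<le> x" if "x \<in> G" for x
    using that fractional_dicolouring_sum_ge_1 by (auto simp: G_def)
  have G_ne: "G \<noteq> {}" using fractional_dicolouring_exists[OF assms(1)] by (auto simp: G_def)
  have GH: "(\<chi> i. 1 / x) \<in> H" if "x \<in> G" for x
    using that hull_of_fractional_dicolouring by (auto simp: G_def H_def)
  have Inf1: "1 \<le> Inf G" using G_ne G1 by (rule cInf_greatest)
  have "Sup {d. (\<chi> i. d) \<in> H} = 1 / Inf G"
  proof (rule cSup_eq_non_empty)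
    show "{d. (\<chi> i. d) \<in> H} \<noteq> {}" using G_ne GH by blast
    show "d \<le> 1 / Inf G" if d: "d \<in> {d. (\<chi> i. d) \<in> H}" for d
    proof (cases "0 < d")
      case True
      then obtain x where x: "x \<in> G" "x \<le> 1 / d"
        using fractional_dicolouring_of_hull[of d A] d by (auto simp: G_def H_def)
      have "Inf G \<le> x" using x(1) G1 by (intro cInf_lower bdd_belowI)
      with x(2) have "Inf G \<le> 1 / d" by simp
      then show ?thesis using True Inf1 by (simp add: field_simps)
    next
      case False
      then have "d \<le> 0" by simp
      also have "0 \<le> 1 / Inf G" using Inf1 by simp
      finally show ?thesis .
    qed
    fix b assume b: "\<And>d. d \<in> {d. (\<chi> i. d) \<in> H} \<Longrightarrow> d \<le> b"
    have inv_le: "1 / x \<le> b" if "x \<in> G" for x using b GH[OF that] by simp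
    obtain x where "x \<in> G" using G_ne by blast
    \<comment> \<open>An upper bound dominates some positive \<open>1 / x\<close>, so its reciprocal
      can be taken.\<close>
    then have "0 < b" using inv_le[of x] G1[of x] by (smt (verit) divide_pos_pos)
    have "1 / b \<le> Inf G"
    proof (rule cInf_greatest[OF G_ne])
      fix x assume "x \<in> G"
      then show "1 / b \<le> x" using inv_le[of x] G1[of x] \<open>0 < b\<close> by (simp add: field_simps)
    qed
    then show "1 / Inf G \<le> b" using \<open>0 < b\<close> Inf1 by (simp add: field_simps)
  qed
  then show ?thesis
    by (simp add: lin_sym_def frac_dichromatic_def lin_region_eq_hull[OF assms] H_def G_def)
qed

theorem theorem9:
  fixes A :: "('v::finite \<times> 'v) set"
  assumes "irrefl A" and "CARD('v) \<le> 4"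
  shows "d_sym_l A = R_sym_l A \<and> R_sym_l A = 1 / frac_dichromatic A"
  by (simp add: d_sym_l_def R_sym_l_def lin_sym_eq_inverse_frac_dichromatic[OF assms])

end
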